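(* Let $A\in\mathbb{R}^{m\times n}$. Then for all $J\in\mathcal{S}(A)$ $$H_J(A)=\max_{y\in\mathbb{R}^m,\ \|y\|\le 1}\ \min_{x\in\mathbb{R}^n,\ A_Jx\le y_J}\|x\|=\frac{1}{\displaystyle\min_{v\in\mathbb{R}^J_+,\ \|v\|^*=1}\|A_J^{\mathsf T}v\|^*},$$ with the convention that the last denominator is $+\infty$, and thus $H_J(A)=0$, when $J=\emptyset$. In particular, $$H(A)=\max_{J\in\mathcal{S}(A)}\frac{1}{\displaystyle\min_{v\in\mathbb{R}^J_+,\ \|v\|^*=1}\|A_J^{\mathsf T}v\|^*}.$$
   Context: $\mathbb{R}^n$ and $\mathbb{R}^m$ are each endowed with an arbitrary norm (not necessarily Euclidean), both denoted $\|\cdot\|$, and with the standard inner product $\langle\cdot,\cdot\rangle$. The dual norm is $\|u\|^*:=\max_{\|x\|\le1}\langle u,x\rangle$. $[m]=\{1,\dots,m\}$. For $J\subseteq[m]$, $A_J$ is the submatrix of $A$ of rows indexed by $J$, $y_J$ the corresponding subvector of $y\in\mathbb{R}^m$. For $v\in\mathbb{R}^J_+$, $\|v\|^*$ is the dual norm in $\mathbb{R}^m$ of $v$ extended by zeros outside $J$. Define $\mathcal{S}(A):=\{J\subseteq[m]: A_J(\mathbb{R}^n)+\mathbb{R}^J_+=\mathbb{R}^J\}$ (with $\emptyset\in\mathcal S(A)$), where $A_J(\mathbb{R}^n)=\{A_Jx:x\in\mathbb{R}^n\}$; for $J\in\mathcal{S}(A)$ $$H_J(A):=\max_{y\in\mathbb{R}^m,\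 \|y\|\le 1}\ \min_{x\in\mathbb{R}^n,\ A_Jx\le y_J}\|x\|,$$ with $H_J(A):=0$ if $J=\emptyset$; and $H(A):=\max_{J\in\mathcal{S}(A)}H_J(A)$. *)

theory Defs
  imports "HOL-Analysis.Analysis"
begin

definition is_norm :: "('a::real_vector \<Rightarrow> real) \<Rightarrow> bool" where
  "is_norm f \<longleftrightarrow>
     (\<forall>x. 0 \<le> f x) \<and> (\<forall>x. f x = 0 \<longleftrightarrow> x = 0) \<and>
     (\<forall>c x. f (c *\<^sub>R x) = \<bar>c\<bar> * f x) \<and> (\<forall>x y. f (x + y) \<le> f x + f y)"

definition dual_norm :: "('a::real_inner \<Rightarrow> real) \<Rightarrow> 'a \<Rightarrow> real" where
  "dual_norm f u = (SUP x\<in>{x. f x \<le> 1}. u \<bullet> x)"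

text \<open>
  For a set \<open>J\<close> of row indices, the space of real vectors indexed by \<open>J\<close> is identified with the
  subspace of \<^typ>\<open>real^'m\<close> of vectors vanishing outside \<open>J\<close>. Accordingly, subvectors and row
  submatrices are padded with zeros outside \<open>J\<close>; in a componentwise inequality between padded
  vectors the entries outside \<open>J\<close> read \<open>0 \<le> 0\<close>.
\<close>

definition coord_space :: "'m set \<Rightarrow> (real^'m) set" where
  "coord_space J = {w. \<forall>i. i \<notin> J \<longrightarrow> w $ i = 0}"

definition coord_orthant :: "'m set \<Rightarrow> (real^'m) set" where
  "coord_orthant J = {w \<in> coord_space J. 0 \<le> w}"

definition subvec :: "real^'m \<Rightarrow> 'm set \<Rightarrow> real^'m" where
  "subvec y J = (\<chi> i. if i \<in> J then y $ i else 0)"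

definition subrows :: "real^'n^'m \<Rightarrow> 'm set \<Rightarrow> real^'n^'m" where
  "subrows A J = (\<chi> i. if i \<in> J then A $ i else 0)"

text \<open>The sum below is the elementwise (Minkowski) sum of sets.\<close>

definition surj_sets :: "real^'n^'m \<Rightarrow> 'm set set" where
  "surj_sets A = {J. range (\<lambda>x. subrows A J *v x) + coord_orthant J = coord_space J}"

text \<open>
  Maxima and minima of real functions over infinite sets are written as suprema and infima;
  for the dual norm, attainment is the lemma \<open>dual_norm_attained\<close> below.
\<close>

definition hoffman_set ::
    "(real^'n \<Rightarrow> real) \<Rightarrow> (real^'m \<Rightarrow> real) \<Rightarrow> real^'n^'m \<Rightarrow> 'm set \<Rightarrow> real" where
  "hoffman_set nX nY A J =
     (if J = {} then 0
      else SUP y\<in>{y. nY y \<le> 1}. INF x\<in>{x. subrows A J *v x \<le> subvec y J}. nX x)"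

definition hoffman ::
    "(real^'n \<Rightarrow> real) \<Rightarrow> (real^'m \<Rightarrow> real) \<Rightarrow> real^'n^'m \<Rightarrow> real" where
  "hoffman nX nY A = Max (hoffman_set nX nY A ` surj_sets A)"

text \<open>
  The infimum is taken in the extended reals, so it is \<open>\<infinity>\<close> when there is no feasible \<open>v\<close>,
  i.e. when \<open>J\<close> is empty; there \<open>1 / \<infinity> = 0\<close>.
\<close>

definition dual_min ::
    "(real^'n \<Rightarrow> real) \<Rightarrow> (real^'m \<Rightarrow> real) \<Rightarrow> real^'n^'m \<Rightarrow> 'm set \<Rightarrow> ereal" where
  "dual_min nX nY A J =
     (INF v\<in>{v \<in> coord_orthant J. dual_norm nY v = 1}.
        ereal (dual_norm nX (transpose (subrows A J) *v v)))"

lemma empty_in_surj_sets: "{} \<in> surj_sets A"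
proof -
  have "coord_space {} = {0}" "coord_orthant {} = {0}"
    by (auto simp: coord_orthant_def coord_space_def vec_eq_iff less_eq_vec_def)
  moreover have "subrows A {} *v x = 0" for x
    by (simp add: subrows_def matrix_vector_mult_def vec_eq_iff)
  ultimately show ?thesis
    by (auto simp: surj_sets_def set_plus_def)
qed

lemma is_norm_continuous_on:
  fixes f :: "'a::euclidean_space \<Rightarrow> real"
  assumes "is_norm f"
  shows "continuous_on UNIV f"
proof -
  have "convex_on UNIV f"
  proof (rule convex_onI)
    fix t :: real and x y :: 'a
    assume "0 < t" "t < 1"
    moreover have "f ((1 - t) *\<^sub>R x + t *\<^sub>R y) \<le> f ((1 - t) *\<^sub>R x) + f (t *\<^sub>R y)"
      using assms unfolding is_norm_def by blast
    moreover have "f (c *\<^sub>R z) = \<bar>c\<bar> * f z" for c z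
      using assms unfolding is_norm_def by blast
    ultimately show "f ((1 - t) *\<^sub>R x + t *\<^sub>R y) \<le> (1 - t) * f x + t * f y"
      by simp
  qed simp
  then show ?thesis
    by (intro convex_on_continuous) auto
qed

lemma is_norm_compact_ball:
  fixes f :: "'a::euclidean_space \<Rightarrow> real"
  assumes "is_norm f"
  shows "compact {x. f x \<le> r}"
proof -
  have cont: "continuous_on UNIV f"
    using assms by (rule is_norm_continuous_on)
  have hom: "f (c *\<^sub>R z) = \<bar>c\<bar> * f z" for c z
    using assms unfolding is_norm_def by blast
  obtain b :: 'a where b: "b \<in> Basis"
    using nonempty_Basis by blast
  have "\<exists>z\<in>sphere 0 1. \<forall>w\<in>sphere 0 1. f z \<le> f w"
    using b by (intro continuous_attains_inf) (auto intro: continuous_on_subset[OF cont])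
  then obtain z :: 'a where z: "norm z = 1" "\<And>w. norm w = 1 \<Longrightarrow> f z \<le> f w"
    by auto
  have pos: "0 < f z"
    using assms z(1) unfolding is_norm_def by (metis norm_zero order_le_less zero_neq_one)
  have "norm x \<le> r / f z" if "f x \<le> r" for x
  proof (cases "x = 0")
    case True
    then show ?thesis
      using assms that pos unfolding is_norm_def by (metis divide_nonneg_pos norm_zero order_trans)
  next
    case False
    then have "f z \<le> f ((1 / norm x) *\<^sub>R x)"
      by (intro z(2)) simp
    also have "\<dots> = f x / norm x"
      using hom[of "1 / norm x" x] by simp
    finally have "f z * norm x \<le> f x"
      using False by (simp add: pos_le_divide_eq)
    with that pos show ?thesis
      by (simp add: field_simps)
  qed
  then have "bounded {x. f x \<le> r}"
    unfolding bounded_iff by blast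
  moreover have "closed {x. f x \<le> r}"
    using cont by (intro closed_Collect_le) auto
  ultimately show ?thesis
    by (simp add: compact_eq_bounded_closed)
qed

lemma dual_norm_attained:
  fixes f :: "'a::euclidean_space \<Rightarrow> real"
  assumes "is_norm f"
  obtains x where "f x \<le> 1" "dual_norm f u = u \<bullet> x" "\<And>z. f z \<le> 1 \<Longrightarrow> u \<bullet> z \<le> u \<bullet> x"
proof -
  have "f 0 \<le> 1"
    using assms unfolding is_norm_def by (metis zero_le_one)
  then have "\<exists>x\<in>{x. f x \<le> 1}. \<forall>z\<in>{x. f x \<le> 1}. u \<bullet> z \<le> u \<bullet> x"
    by (intro continuous_attains_sup is_norm_compact_ball[OF assms] continuous_intros) auto
  then obtain x where x: "f x \<le> 1" "\<And>z. f z \<le> 1 \<Longrightarrow> u \<bullet> z \<le> u \<bullet> x"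
    by blast
  then have "dual_norm f u = u \<bullet> x"
    unfolding dual_norm_def by (intro cSup_eq_maximum) auto
  with x show ?thesis
    using that by blast
qed

end

theory Submission
  imports Defs
begin

text \<open>
  If \<open>A\<^sub>J x \<le> y\<^sub>J\<close> and \<open>v\<close> is a nonnegative vector supported on \<open>J\<close>, pairing with \<open>v\<close> bounds
  \<open>\<parallel>x\<parallel>\<close> below by \<open>- \<langle>v, y\<rangle> / \<parallel>A\<^sub>J\<^sup>T v\<parallel>\<^sup>*\<close>. At a minimiser \<open>v\<close> and a \<open>y\<close> norming \<open>- v\<close> this is
  the reciprocal \<open>1 / \<rho>\<close> of the dual minimum. Conversely, were there no feasible \<open>x\<close> of norm at most
  \<open>1 / \<rho>\<close>, then \<open>y\<^sub>J\<close> would lie outside the closed convex set formed by adding the orthant to the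
  image of that ball, and a separating functional, necessarily nonnegative on \<open>J\<close>, would contradict
  the minimality of \<open>\<rho>\<close>. Membership of \<open>J\<close> in \<open>\<S>(A)\<close> only enters to show \<open>\<rho> > 0\<close>.
\<close>

section \<open>The dual norm as a norm\<close>

lemma is_norm_uminus:
  assumes "is_norm f"
  shows "f (- x) = f x"
proof -
  have "f ((-1) *\<^sub>R x) = \<bar>-1\<bar> * f x"
    using assms unfolding is_norm_def by blast
  then show ?thesis by simp
qed

lemma dual_norm_upper:
  fixes f :: "'a::euclidean_space \<Rightarrow> real"
  assumes "is_norm f" "f x \<le> 1"
  shows "u \<bullet> x \<le> dual_norm f u"
  using dual_norm_attained[OF assms(1), of u] assms(2) by metis

lemma inner_le_dual_norm_mult:
  fixes f :: "'a::euclidean_space \<Rightarrow> real"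
  assumes f: "is_norm f"
  shows "u \<bullet> x \<le> dual_norm f u * f x"
proof (cases "x = 0")
  case True
  moreover have "f 0 = 0" using f unfolding is_norm_def by blast
  ultimately show ?thesis by simp
next
  case False
  then have pos: "0 < f x"
    using f unfolding is_norm_def by (metis order_le_less)
  have "f ((1 / f x) *\<^sub>R x) = \<bar>1 / f x\<bar> * f x"
    using f unfolding is_norm_def by blast
  then have "u \<bullet> ((1 / f x) *\<^sub>R x) \<le> dual_norm f u"
    using pos by (intro dual_norm_upper[OF f]) simp
  with pos show ?thesis by (simp add: field_simps)
qed

text \<open>Makes the continuity and compact-ball facts for norms available for dual norms, which
  gives attainment of the dual minimum.\<close>

lemma is_norm_dual_norm:
  fixes f :: "'a::euclidean_space \<Rightarrow> real"
  assumes f: "is_norm f"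
  shows "is_norm (dual_norm f)"
proof -
  have f0: "f 0 = 0" using f unfolding is_norm_def by blast
  have nonneg: "0 \<le> dual_norm f u" for u
    using dual_norm_upper[OF f, of 0 u] f0 by simp
  have zero: "dual_norm f u = 0 \<longleftrightarrow> u = 0" for u
  proof
    assume "dual_norm f u = 0"
    then have "u \<bullet> u \<le> 0" using inner_le_dual_norm_mult[OF f, of u u] by simp
    then show "u = 0" by (metis inner_ge_zero inner_eq_zero_iff order_antisym)
  next
    assume "u = 0"
    then show "dual_norm f u = 0" using dual_norm_attained[OF f, of u] by force
  qed
  have triangle: "dual_norm f (u + v) \<le> dual_norm f u + dual_norm f v" for u v
  proof -
    obtain x where "f x \<le> 1" "dual_norm f (u + v) = (u + v) \<bullet> x"
      using dual_norm_attained[OF f] by metis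
    then show ?thesis
      using dual_norm_upper[OF f, of x u] dual_norm_upper[OF f, of x v] by (simp add: inner_left_distrib)
  qed
  have scale_le: "dual_norm f (c *\<^sub>R u) \<le> \<bar>c\<bar> * dual_norm f u" for c u
  proof -
    obtain x where x: "f x \<le> 1" "dual_norm f (c *\<^sub>R u) = (c *\<^sub>R u) \<bullet> x"
      using dual_norm_attained[OF f] by metis
    \<comment> \<open>For negative \<open>c\<close> the bound comes from \<open>- x\<close>, which
      lies in the unit ball as well.\<close>
    have "sgn c * (u \<bullet> x) \<le> dual_norm f u"
      using dual_norm_upper[OF f, of x u] dual_norm_upper[OF f, of "- x" u] x(1) nonneg[of u]
      by (auto simp: sgn_if is_norm_uminus[OF f])
    then have "\<bar>c\<bar> * (sgn c * (u \<bullet> x)) \<le> \<bar>c\<bar> * dual_norm f u"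
      by (intro mult_left_mono) auto
    moreover have "\<bar>c\<bar> * (sgn c * (u \<bullet> x)) = c * (u \<bullet> x)"
      by (metis mult.assoc mult.commute sgn_mult_abs)
    ultimately show ?thesis using x(2) by simp
  qed
  have scale: "dual_norm f (c *\<^sub>R u) = \<bar>c\<bar> * dual_norm f u" for c u
  proof (cases "c = 0")
    case True
    then show ?thesis using zero[of 0] by simp
  next
    case False
    \<comment> \<open>The reverse inequality is \<open>scale_le\<close> for the inverse scalar
      applied to the scaled vector.\<close>
    have "dual_norm f u \<le> \<bar>1 / c\<bar> * dual_norm f (c *\<^sub>R u)"
      using scale_le[of "1 / c" "c *\<^sub>R u"] False by simp
    then have "\<bar>c\<bar> * dual_norm f u \<le> dual_norm f (c *\<^sub>R u)"
      using False by (simp add: field_simps)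
    with scale_le[of c u] show ?thesis by simp
  qed
  show ?thesis
    unfolding is_norm_def using nonneg zero triangle scale by blast
qed

section \<open>Orthants supported on \<open>J\<close> and adjoint identities\<close>

lemma coord_orthant_iff:
  "w \<in> coord_orthant J \<longleftrightarrow> (\<forall>i. 0 \<le> w $ i \<and> (i \<notin> J \<longrightarrow> w $ i = 0))"
  by (auto simp: coord_orthant_def coord_space_def less_eq_vec_def)

lemma closed_coord_orthant: "closed (coord_orthant J :: (real^'m) set)"
proof -
  have "closed {w :: real^'m. \<forall>i. 0 \<le> w $ i \<and> (i \<notin> J \<longrightarrow> w $ i = 0)}"
    by (intro closed_Collect_all closed_Collect_conj closed_Collect_imp closed_Collect_le
        closed_Collect_eq continuous_intros) auto
  then show ?thesis by (simp add: coord_orthant_iff[symmetric])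
qed

lemma convex_coord_orthant: "convex (coord_orthant J)"
  by (auto simp: convex_def coord_orthant_iff)

lemma coord_orthant_scaleR:
  "w \<in> coord_orthant J \<Longrightarrow> 0 \<le> c \<Longrightarrow> c *\<^sub>R w \<in> coord_orthant J"
  by (auto simp: coord_orthant_iff)

lemma inner_transpose: "(transpose B *v v) \<bullet> x = v \<bullet> (B *v (x::real^'n))"
  for B :: "real^'n^'m"
  by (simp add: dot_lmul_matrix)

lemma inner_subvec: "subvec v J \<bullet> w = v \<bullet> subvec w J"
  by (auto simp: inner_vec_def subvec_def intro!: sum.cong)

lemma subvec_matrix_mult: "subvec (subrows A J *v x) J = subrows A J *v x"
  by (auto simp: subvec_def subrows_def vec_eq_iff matrix_vector_mult_def)

lemma subvec_coord_orthant: "v \<in> coord_orthant J \<Longrightarrow> subvec v J = v"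
  by (auto simp: subvec_def coord_orthant_iff vec_eq_iff)

text \<open>The easy half of a theorem of the alternative. Surjectivity writes \<open>- v\<close> as
  an image point plus some \<open>w\<close> in the orthant. If the transpose killed
  \<open>v\<close>, pairing with \<open>v\<close> would leave
  \<open>- (v \<bullet> v) = v \<bullet> w \<ge> 0\<close>.\<close>

lemma transpose_mult_ne_0:
  assumes J: "J \<in> surj_sets A" and v: "v \<in> coord_orthant J" "v \<noteq> 0"
  shows "transpose (subrows A J) *v v \<noteq> 0"
proof
  assume zero: "transpose (subrows A J) *v v = 0"
  have "- v \<in> coord_space J"
    using v(1) by (auto simp: coord_orthant_def coord_space_def)
  then have "- v \<in> range (\<lambda>x. subrows A J *v x) + coord_orthant J"
    using J by (simp add: surj_sets_def)
  then obtain x w where w: "- v = subrows A J *v x + w" "w \<in> coord_orthant J"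
    by (blast elim: set_plus_elim)
  have "v \<bullet> (- v) = v \<bullet> w"
    unfolding w(1) inner_right_distrib inner_transpose[symmetric] zero by simp
  moreover have "0 \<le> v \<bullet> w"
    using v(1) w(2) by (auto simp: inner_vec_def coord_orthant_iff intro!: sum_nonneg)
  moreover have "0 < v \<bullet> v" using v(2) by simp
  ultimately show False by simp
qed

section \<open>Weak duality and its converse by separation\<close>

lemma weak_duality:
  assumes nX: "is_norm nX" and v: "v \<in> coord_orthant J"
    and x: "subrows A J *v x \<le> subvec y J"
  shows "(- v) \<bullet> y \<le> dual_norm nX (transpose (subrows A J) *v v) * nX x"
proof -
  have "v \<bullet> (subrows A J *v x) \<le> v \<bullet> subvec y J"
    using v x by (auto simp: inner_vec_def coord_orthant_iff less_eq_vec_def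
        intro!: sum_mono mult_left_mono)
  also have "\<dots> = v \<bullet> y"
    by (metis inner_subvec subvec_coord_orthant v)
  finally have "(- v) \<bullet> y \<le> (transpose (subrows A J) *v v) \<bullet> (- x)"
    by (simp only: inner_minus_left inner_minus_right inner_transpose)
  also have "\<dots> \<le> dual_norm nX (transpose (subrows A J) *v v) * nX x"
    using inner_le_dual_norm_mult[OF nX, of _ "- x"] is_norm_uminus[OF nX] by metis
  finally show ?thesis .
qed

text \<open>Minimality is put in homogeneous form, valid for every \<open>w\<close> in the orthant,
  so that it applies directly to the unnormalised functional produced by separation.\<close>

lemma dual_min_attained:
  fixes A :: "real^'n^'m"
  assumes nX: "is_norm nX" and nY: "is_norm nY" and "J \<noteq> {}"
  obtains v where "v \<in> coord_orthant J" "dual_norm nY v = 1"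
    "\<And>w. w \<in> coord_orthant J \<Longrightarrow>
      dual_norm nX (transpose (subrows A J) *v v) * dual_norm nY w
        \<le> dual_norm nX (transpose (subrows A J) *v w)"
proof -
  define K where "K = {v \<in> coord_orthant J. dual_norm nY v = 1}"
  define g where "g = (\<lambda>v. dual_norm nX (transpose (subrows A J) *v v))"
  note norm_dX = is_norm_dual_norm[OF nX] and norm_dY = is_norm_dual_norm[OF nY]
  have dX: "dual_norm nX (c *\<^sub>R u) = \<bar>c\<bar> * dual_norm nX u" "0 \<le> dual_norm nX u" for c u
    using norm_dX unfolding is_norm_def by blast+
  have dY: "dual_norm nY (c *\<^sub>R u) = \<bar>c\<bar> * dual_norm nY u" "0 \<le> dual_norm nY u"
    "dual_norm nY u = 0 \<longleftrightarrow> u = 0" for c u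
    using norm_dY unfolding is_norm_def by blast+
  have normalise: "(1 / dual_norm nY w) *\<^sub>R w \<in> K" if "w \<in> coord_orthant J" "w \<noteq> 0" for w
    using that dY(2)[of w] dY(3)[of w] by (simp add: K_def dY(1) coord_orthant_scaleR)
  obtain j where "j \<in> J" using \<open>J \<noteq> {}\<close> by blast
  then have "axis j 1 \<in> coord_orthant J" "axis j (1::real) \<noteq> 0"
    by (auto simp: coord_orthant_iff axis_def vec_eq_iff)
  then have "K \<noteq> {}" using normalise by blast
  moreover have "compact K"
  proof -
    \<comment> \<open>Exhibits \<open>K\<close> as a compact ball intersected with a closed
      set.\<close>
    have "K = {v. dual_norm nY v \<le> 1} \<inter> (coord_orthant J \<inter> {v. dual_norm nY v = 1})"
      by (auto simp: K_def)
    moreover have "closed {v. dual_norm nY v = 1}"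
      by (intro closed_Collect_eq is_norm_continuous_on[OF norm_dY] continuous_intros)
    ultimately show ?thesis
      using is_norm_compact_ball[OF norm_dY, of 1] closed_coord_orthant[of J]
      by (simp add: compact_Int_closed closed_Int)
  qed
  moreover have "continuous_on K g"
    unfolding g_def
    by (intro continuous_on_compose2[OF is_norm_continuous_on[OF norm_dX]]
        matrix_vector_mult_linear_continuous_on) auto
  ultimately obtain v where v: "v \<in> K" "\<And>w. w \<in> K \<Longrightarrow> g v \<le> g w"
    using continuous_attains_inf by metis
  have "g v * dual_norm nY w \<le> g w" if w: "w \<in> coord_orthant J" for w
  proof (cases "w = 0")
    case True
    then show ?thesis using dX(2) dY(3)[of 0] by (simp add: g_def)
  next
    case False
    then have pos: "0 < dual_norm nY w" using dY(2)[of w] dY(3)[of w] by linarith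
    have "g v \<le> g ((1 / dual_norm nY w) *\<^sub>R w)"
      by (intro v(2) normalise w False)
    also have "\<dots> = g w / dual_norm nY w"
      unfolding g_def matrix_vector_mult_scaleR dX(1) using pos by simp
    finally show ?thesis using pos by (simp add: field_simps)
  qed
  with v(1) show ?thesis
    using that unfolding K_def g_def by blast
qed

text \<open>A Farkas lemma with a radius: any positive lower bound \<open>\<rho>\<close> for the
  ratio of the two dual norms on the orthant bounds the size of a solution.\<close>

lemma feasible_in_ball:
  fixes A :: "real^'n^'m"
  assumes nX: "is_norm nX" and nY: "is_norm nY" and "0 < \<rho>"
    and \<rho>: "\<And>v. v \<in> coord_orthant J \<Longrightarrow>
      \<rho> * dual_norm nY v \<le> dual_norm nX (transpose (subrows A J) *v v)"
    and y: "nY y \<le> 1"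
  obtains x where "subrows A J *v x \<le> subvec y J" "nX x \<le> 1 / \<rho>"
proof (rule ccontr)
  assume "\<not> thesis"
  with that have no: "\<not> subrows A J *v x \<le> subvec y J" if "nX x \<le> 1 / \<rho>" for x
    using \<open>nX x \<le> 1 / \<rho>\<close> by blast
  define B where "B = subrows A J"
  define D where "D = {x. nX x \<le> 1 / \<rho>}"
  define S where "S = (\<Union>a\<in>(\<lambda>x. B *v x) ` D. \<Union>w\<in>coord_orthant J. {a + w})"
  have nX_scale: "nX (c *\<^sub>R x) = \<bar>c\<bar> * nX x" and nX_add: "nX (x + z) \<le> nX x + nX z"
    and nX0: "nX 0 = 0" for c x z
    using nX unfolding is_norm_def by blast+
  have "convex D"
  proof (rule convexI)
    fix x z :: "real^'n" and a b :: real
    assume *: "x \<in> D" "z \<in> D" "0 \<le> a" "0 \<le> b" "a + b = 1"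
    have "nX (a *\<^sub>R x + b *\<^sub>R z) \<le> a * nX x + b * nX z"
      using nX_add[of "a *\<^sub>R x" "b *\<^sub>R z"] * by (simp add: nX_scale)
    also have "\<dots> \<le> 1 / \<rho>"
      using * by (intro convex_bound_le) (auto simp: D_def)
    finally show "a *\<^sub>R x + b *\<^sub>R z \<in> D" by (simp add: D_def)
  qed
  have "compact D" unfolding D_def by (rule is_norm_compact_ball[OF nX])
  have D0: "0 \<in> D" using \<open>0 < \<rho>\<close> by (simp add: D_def nX0)
  have convS: "convex S"
    unfolding S_def
    by (intro convex_sums convex_linear_image \<open>convex D\<close> convex_coord_orthant
        matrix_vector_mul_linear)
  \<comment> \<open>A sum of two closed sets may fail to be closed; compactness of the image of
    \<open>D\<close> is what saves it.\<close>
  have closedS: "closed S"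
    unfolding S_def
    by (intro compact_closed_sums compact_continuous_image \<open>compact D\<close> closed_coord_orthant
        matrix_vector_mult_linear_continuous_on)
  have "subvec y J \<notin> S"
  proof
    assume "subvec y J \<in> S"
    then obtain x w where "x \<in> D" "w \<in> coord_orthant J" "subvec y J = B *v x + w"
      by (auto simp: S_def)
    then show False
      using no[of x] by (auto simp: D_def B_def coord_orthant_iff less_eq_vec_def)
  qed
  then obtain a b where sep: "a \<bullet> subvec y J < b" "\<And>s. s \<in> S \<Longrightarrow> b < a \<bullet> s"
    using separating_hyperplane_closed_point[OF convS closedS] by blast
  have sepS: "b < a \<bullet> (B *v x) + a \<bullet> w" if "x \<in> D" "w \<in> coord_orthant J" for x w
    using sep(2)[of "B *v x + w"] that by (auto simp: S_def inner_right_distrib)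
  \<comment> \<open>Separation says nothing about the entries of \<open>a\<close> outside
    \<open>J\<close>. Cutting them off changes no pairing with vectors supported on
    \<open>J\<close>.\<close>
  define v where "v = subvec a J"
  have "0 \<le> a $ i" if "i \<in> J" for i
  proof (rule ccontr)
    assume "\<not> 0 \<le> a $ i"
    then have neg: "a $ i < 0" by simp
    \<comment> \<open>Chosen so that \<open>a $ i * t = - \<bar>b\<bar>\<close>, whereas separation
      at \<open>x = 0\<close> demands a value above \<open>b\<close>.\<close>
    define t where "t = \<bar>b\<bar> / - (a $ i)"
    have "0 \<le> t" using neg by (simp add: t_def divide_nonneg_neg)
    then have "axis i t \<in> coord_orthant J"
      using that by (auto simp: coord_orthant_iff axis_def)
    from sepS[OF D0 this] have "b < a $ i * t"
      by (simp add: inner_axis)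
    also have "\<dots> = - \<bar>b\<bar>" using neg by (simp add: t_def)
    finally show False by linarith
  qed
  then have v: "v \<in> coord_orthant J" by (auto simp: v_def subvec_def coord_orthant_iff)
  have K0: "0 \<in> coord_orthant J" by (simp add: coord_orthant_iff)
  have sep_v: "v \<bullet> y < (transpose B *v v) \<bullet> x" if "x \<in> D" for x
  proof -
    have "v \<bullet> y = a \<bullet> subvec y J" by (simp add: v_def inner_subvec)
    also have "\<dots> < a \<bullet> (B *v x)"
      using sep(1) sepS[OF that K0] by simp
    also have "\<dots> = v \<bullet> (B *v x)"
      unfolding v_def B_def inner_subvec subvec_matrix_mult ..
    finally show ?thesis unfolding inner_transpose .
  qed
  obtain x where x: "nX x \<le> 1" "dual_norm nX (transpose B *v v) = (transpose B *v v) \<bullet> x"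
    using dual_norm_attained[OF nX] by metis
  \<comment> \<open>This point makes the pairing as negative as possible on \<open>D\<close>. The
    result is the impossible chain \<open>dual_norm nY v \<ge> v \<bullet> (- y) > dual_norm nX
    (transpose B *v v) / \<rho> \<ge> dual_norm nY v\<close>.\<close>
  have "(- (1 / \<rho>)) *\<^sub>R x \<in> D"
    unfolding D_def mem_Collect_eq nX_scale using x(1) \<open>0 < \<rho>\<close> by (simp add: field_simps)
  from sep_v[OF this] have "v \<bullet> y < - (dual_norm nX (transpose B *v v) / \<rho>)"
    using x(2) by simp
  moreover have "v \<bullet> (- y) \<le> dual_norm nY v"
    using dual_norm_upper[OF nY, of "- y"] y is_norm_uminus[OF nY] by metis
  moreover have "dual_norm nY v \<le> dual_norm nX (transpose B *v v) / \<rho>"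
    using \<rho>[OF v] \<open>0 < \<rho>\<close> by (simp add: B_def field_simps)
  ultimately show False by simp
qed

section \<open>Attainment of extrema\<close>

lemma closed_feasible: "closed {x. subrows A J *v x \<le> subvec y J}"
  unfolding less_eq_vec_def
  by (intro closed_Collect_all closed_Collect_le continuous_intros
      continuous_on_component matrix_vector_mult_linear_continuous_on)

text \<open>The point \<open>z\<close> cuts \<open>C\<close> down to a compact sublevel set; points
  of \<open>C\<close> outside it have larger norm than \<open>z\<close>.\<close>

lemma min_norm_attained:
  fixes nX :: "real^'n \<Rightarrow> real"
  assumes nX: "is_norm nX" and C: "closed C" "z \<in> C"
  shows "\<exists>x. is_arg_min nX (\<lambda>x. x \<in> C) x"
proof -
  have "compact ({x. nX x \<le> nX z} \<inter> C)"
    by (intro compact_Int_closed is_norm_compact_ball[OF nX] C)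
  then obtain x where x: "x \<in> {x. nX x \<le> nX z} \<inter> C"
    "\<And>w. w \<in> {x. nX x \<le> nX z} \<inter> C \<Longrightarrow> nX x \<le> nX w"
    using continuous_attains_inf[of "{x. nX x \<le> nX z} \<inter> C" nX]
      continuous_on_subset[OF is_norm_continuous_on[OF nX]] C(2) by blast
  have "nX x \<le> nX w" if "w \<in> C" for w
    using x that by (cases "nX w \<le> nX z") auto
  with x(1) show ?thesis unfolding is_arg_min_linorder by blast
qed

lemma INF_is_arg_min:
  fixes f :: "'a \<Rightarrow> real"
  assumes "is_arg_min f P x"
  shows "(INF x\<in>{x. P x}. f x) = f x"
  using assms unfolding is_arg_min_linorder by (intro cInf_eq_minimum) auto

lemma SUP_is_arg_max:
  fixes f :: "'a \<Rightarrow> real"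
  assumes "is_arg_max f P x"
  shows "(SUP x\<in>{x. P x}. f x) = f x"
  using assms unfolding is_arg_max_linorder by (intro cSup_eq_maximum) auto

text \<open>The attainment clauses certify that the suprema and infima are genuine maxima and
  minima. Empty \<open>J\<close> is treated apart, because the dual problem then has no feasible
  vector.\<close>

lemma hoffman_set_duality:
  fixes A :: "real^'n^'m" and J :: "'m set"
    and nX :: "real^'n \<Rightarrow> real" and nY :: "real^'m \<Rightarrow> real"
  defines "\<phi> y \<equiv> INF x\<in>{x. subrows A J *v x \<le> subvec y J}. nX x"
  assumes nX: "is_norm nX" and nY: "is_norm nY" and J: "J \<in> surj_sets A"
  shows "(\<forall>y. nY y \<le> 1 \<longrightarrow> (\<exists>x. is_arg_min nX (\<lambda>x. subrows A J *v x \<le> subvec y J) x)) \<and>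
    (\<exists>y. is_arg_max \<phi> (\<lambda>y. nY y \<le> 1) y) \<and>
    (J \<noteq> {} \<longrightarrow> (\<exists>v. is_arg_min (\<lambda>v. dual_norm nX (transpose (subrows A J) *v v))
                      (\<lambda>v. v \<in> coord_orthant J \<and> dual_norm nY v = 1) v)) \<and>
    hoffman_set nX nY A J = (SUP y\<in>{y. nY y \<le> 1}. \<phi> y) \<and>
    ereal (hoffman_set nX nY A J) = 1 / dual_min nX nY A J"
proof -
  have nX_nonneg: "0 \<le> nX x" and nX0: "nX 0 = 0" and nY0: "nY 0 = 0" for x
    using nX nY unfolding is_norm_def by blast+
  show ?thesis
  proof (cases "J = {}")
    case True
    have "subrows A J *v x \<le> subvec y J" for x y
      by (simp add: True subrows_def subvec_def less_eq_vec_def matrix_vector_mult_def)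
    then have min0: "is_arg_min nX (\<lambda>x. subrows A J *v x \<le> subvec y J) 0" for y
      using nX0 nX_nonneg by (simp add: is_arg_min_linorder)
    have \<phi>0: "\<phi> y = 0" for y
      unfolding \<phi>_def using INF_is_arg_min[OF min0] nX0 by simp
    have max0: "is_arg_max \<phi> (\<lambda>y. nY y \<le> 1) 0"
      by (simp add: is_arg_max_linorder \<phi>0 nY0)
    have "coord_orthant J = {0}"
      using True by (auto simp: coord_orthant_iff vec_eq_iff)
    moreover have "dual_norm nY 0 = 0"
      using is_norm_dual_norm[OF nY] unfolding is_norm_def by blast
    ultimately have "{v \<in> coord_orthant J. dual_norm nY v = 1} = {}" by auto
    \<comment> \<open>The infimum of the empty set is the top element of the extended reals, and
      \<open>1 / \<infinity> = 0\<close> agrees with the value assigned to empty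
      \<open>J\<close>.\<close>
    then have "dual_min nX nY A J = \<infinity>"
      unfolding dual_min_def by (simp only: INF_empty top_ereal_def)
    then have "ereal (hoffman_set nX nY A J) = 1 / dual_min nX nY A J"
      using True by (simp add: hoffman_set_def)
    moreover have "hoffman_set nX nY A J = (SUP y\<in>{y. nY y \<le> 1}. \<phi> y)"
      using SUP_is_arg_max[OF max0] \<phi>0[of 0] True by (simp add: hoffman_set_def)
    ultimately show ?thesis
      using min0 max0 True by blast
  next
    case False
    obtain v where v: "v \<in> coord_orthant J" "dual_norm nY v = 1"
      and v_min: "\<And>w. w \<in> coord_orthant J \<Longrightarrow>
        dual_norm nX (transpose (subrows A J) *v v) * dual_norm nY w
          \<le> dual_norm nX (transpose (subrows A J) *v w)"
      using dual_min_attained[OF nX nY False] by metis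
    define \<rho> where "\<rho> = dual_norm nX (transpose (subrows A J) *v v)"
    have "dual_norm nY 0 = 0"
      using is_norm_dual_norm[OF nY] unfolding is_norm_def by blast
    then have "v \<noteq> 0" using v(2) by auto
    then have "transpose (subrows A J) *v v \<noteq> 0"
      by (rule transpose_mult_ne_0[OF J v(1)])
    then have \<rho>: "0 < \<rho>"
      using is_norm_dual_norm[OF nX] unfolding is_norm_def \<rho>_def by (metis order_le_less)
    have v_arg: "is_arg_min (\<lambda>v. dual_norm nX (transpose (subrows A J) *v v))
        (\<lambda>v. v \<in> coord_orthant J \<and> dual_norm nY v = 1) v"
      using v v_min by (force simp: is_arg_min_linorder)
    have min: "\<exists>x. is_arg_min nX (\<lambda>x. subrows A J *v x \<le> subvec y J) x \<and> \<phi> y = nX x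
        \<and> nX x \<le> 1 / \<rho>" if y: "nY y \<le> 1" for y
    proof -
      obtain z where z: "subrows A J *v z \<le> subvec y J" "nX z \<le> 1 / \<rho>"
        using feasible_in_ball[OF nX nY \<rho> _ y, of J A] v_min unfolding \<rho>_def by blast
      obtain x where x: "is_arg_min nX (\<lambda>x. subrows A J *v x \<le> subvec y J) x"
        using min_norm_attained[OF nX closed_feasible, of z A J y] z(1) by auto
      then have "nX x \<le> nX z" using z(1) by (simp add: is_arg_min_linorder)
      then show ?thesis
        using x z(2) INF_is_arg_min[OF x] unfolding \<phi>_def by auto
    qed
    \<comment> \<open>The vector \<open>u\<close> norms the dual minimiser. At the right-hand side
      \<open>- u\<close>, weak duality reads \<open>1 \<le> \<rho> * nX x\<close>, which meets the
      upper bound \<open>1 / \<rho>\<close> on the minimal norm.\<close>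
    obtain u where u: "nY u \<le> 1" "v \<bullet> u = 1"
      using dual_norm_attained[OF nY, of v] v(2) by metis
    have u': "nY (- u) \<le> 1" using u(1) is_norm_uminus[OF nY] by simp
    obtain x where x: "is_arg_min nX (\<lambda>x. subrows A J *v x \<le> subvec (- u) J) x"
      "\<phi> (- u) = nX x" "nX x \<le> 1 / \<rho>"
      using min[OF u'] by blast
    have "(- v) \<bullet> (- u) \<le> \<rho> * nX x"
      unfolding \<rho>_def using x(1)
      by (intro weak_duality[OF nX v(1)]) (simp add: is_arg_min_linorder)
    then have \<phi>_u: "\<phi> (- u) = 1 / \<rho>"
      using u(2) x(2,3) \<rho> by (simp add: field_simps)
    have max: "is_arg_max \<phi> (\<lambda>y. nY y \<le> 1) (- u)"
      unfolding is_arg_max_linorder \<phi>_u using u' min by metis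
    have sup: "(SUP y\<in>{y. nY y \<le> 1}. \<phi> y) = 1 / \<rho>"
      using SUP_is_arg_max[OF max] \<phi>_u by simp
    have "dual_min nX nY A J = ereal \<rho>"
      unfolding dual_min_def \<rho>_def using v v_arg
      by (intro antisym INF_lower INF_greatest) (auto simp: is_arg_min_linorder)
    then have "1 / dual_min nX nY A J = ereal (1 / \<rho>)"
      using \<rho> by (simp add: one_ereal_def)
    moreover have hs: "hoffman_set nX nY A J = (SUP y\<in>{y. nY y \<le> 1}. \<phi> y)"
      using False by (simp add: hoffman_set_def \<phi>_def)
    ultimately have "ereal (hoffman_set nX nY A J) = 1 / dual_min nX nY A J"
      using sup by simp
    with hs show ?thesis
      using min max v_arg by blast
  qed
qed

theorem proposition2:
  fixes A :: "real^'n^'m"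
    and nX :: "real^'n \<Rightarrow> real" and nY :: "real^'m \<Rightarrow> real"
  assumes "is_norm nX" and "is_norm nY"
  shows "(\<forall>J\<in>surj_sets A.
            (\<forall>y. nY y \<le> 1 \<longrightarrow>
               (\<exists>x. is_arg_min nX (\<lambda>x. subrows A J *v x \<le> subvec y J) x)) \<and>
            (\<exists>y. is_arg_max (\<lambda>y. INF x\<in>{x. subrows A J *v x \<le> subvec y J}. nX x)
                   (\<lambda>y. nY y \<le> 1) y) \<and>
            (J \<noteq> {} \<longrightarrow>
               (\<exists>v. is_arg_min (\<lambda>v. dual_norm nX (transpose (subrows A J) *v v))
                      (\<lambda>v. v \<in> coord_orthant J \<and> dual_norm nY v = 1) v)) \<and>
            hoffman_set nX nY A J =
              (SUP y\<in>{y. nY y \<le> 1}. INF x\<in>{x. subrows A J *v x \<le> subvec y J}. nX x) \<and>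
            ereal (hoffman_set nX nY A J) = 1 / dual_min nX nY A J) \<and>
         ereal (hoffman nX nY A) = Max ((\<lambda>J. 1 / dual_min nX nY A J) ` surj_sets A)"
proof (rule conjI)
  \<comment> \<open>The monotone map \<open>ereal\<close> commutes with the maximum of a finite set,
    nonempty because \<open>{}\<close> belongs to \<open>surj_sets A\<close>.\<close>
  have "ereal (hoffman nX nY A) = Max (ereal ` hoffman_set nX nY A ` surj_sets A)"
    unfolding hoffman_def using empty_in_surj_sets[of A]
    by (intro mono_Max_commute) (auto simp: mono_def)
  also have "ereal ` hoffman_set nX nY A ` surj_sets A
      = (\<lambda>J. 1 / dual_min nX nY A J) ` surj_sets A"
    unfolding image_image using hoffman_set_duality[OF assms] by (intro image_cong refl) blast
  finally show "ereal (hoffman nX nY A) = Max ((\<lambda>J. 1 / dual_min nX nY A J) ` surj_sets A)" .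
qed (rule ballI, rule hoffman_set_duality[OF assms])

end
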